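(* Let $(S,A,d,P,P_0)$ be a finite-horizon Markov decision process of horizon $T$ with non-negative danger function $d$ and initial state distribution $P_0$, let $\beta\in[0,1)$ and $c\ge 0$, and set $$x^*_c=c\Bigl(1+\sum_{t=1}^{T-1}\beta^t\Bigr)^{-1}.$$ Let $\eta$ be a policy (the baseline policy) satisfying $\mathscr{T}_0^{\eta}(s_0)\le x^*_c$ for every initial state $s_0$. Then every policy $\pi\in\Pi_1^{\eta,x^*_c}$ is safe, i.e. $E_\pi\bigl[\mathscr{T}_0^{\pi}(s_0,a_0)\bigr]\le c$, where $s_0\sim P_0$ and $a_0$ is drawn from $\pi$ at state $s_0$ and time $0$.
   Context: Setting: a discrete-time Markov decision process with horizon $T$. $S$ is the set of states, $A$ is the (discrete) set of actions, $P(s,a,s')$ is the probability (density) of the transition from $s$ to $s'$ under action $a$, $P_0$ is the distribution of the initial state, and $d(s,a)\ge 0$ is the danger of taking action $a$ at state $s$; write $d_{t+1}=d(s_t,a_t)$. A policy gives, for each state $s$ (and possibly each time $t$), a probability distribution on $A$; $E_\pi$ denotes expectation when actions are drawn from $\pi$ and states evolve by $P$ (and $s_0\sim P_0$ when no conditioning on the state is indicated). "Every initial state" means every state that can occur as initial state ($P_0$-almost every $s_0$). Threat function: for a policy $\eta$ and $t\in\{0,\dots,T\}$, $$\mathscr{T}_t^{\eta}(s,a)=E_\eta\Bigl[\sum_{k=t+1}^{T}\beta^{k-t}d_k\,\Big|\,s_t=s,\ a_t=a\Bigr]$$ (the empty sum for $t=T$ is $0$), and $\mathscr{T}_0^{\eta}(s_0)=E_{\eta}[\mathscr{T}_0^{\eta}(s_0,a_0)\mid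 s_0]$. For a constant $x\ge 0$ (the same threshold at all times): $A^{\eta,x}(s)=\bigcap_{t=0}^{T}\{a\in A:\mathscr{T}_t^{\eta}(s,a)\le x\}$ and $S^{\eta,x}=\{s\in S:A^{\eta,x}(s)\neq\emptyset\}$. $\Pi_1^{\eta,x}$ is the set of policies $\pi$ such that: at every $s\in S^{\eta,x}$, the action distribution of $\pi$ is supported in $A^{\eta,x}(s)$ (at every time); and at every $s\notin S^{\eta,x}$, at time $t$, $\pi$ deterministically takes an action minimizing $a\mapsto\mathscr{T}_t^{\eta}(s,a)$ over $A$. *)

theory Defs
  imports "HOL-Probability.Probability"
begin

text \<open>
  The action set is the type \<open>'a\<close> with the discrete sigma-algebra. The state space is an arbitrary
  measurable space and \<open>transition M s a\<close> is the law of the successor state; this covers both a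
  transition mass function (discrete states) and a transition density with respect to some
  reference measure.
\<close>

record ('s, 'a) mdp =
  states :: "'s measure"
  transition :: "'s \<Rightarrow> 'a \<Rightarrow> 's measure"
  initial :: "'s measure"
  danger :: "'s \<Rightarrow> 'a \<Rightarrow> real"
  horizon :: nat

abbreviation state_actions :: "('s, 'a) mdp \<Rightarrow> ('s \<times> 'a) measure" where
  "state_actions M \<equiv> states M \<Otimes>\<^sub>M count_space UNIV"

text \<open>Elements of \<open>prob_algebra N\<close> are the probability measures on the measurable space \<open>N\<close>.\<close>

definition is_mdp :: "('s, 'a) mdp \<Rightarrow> bool" where
  "is_mdp M \<longleftrightarrow>
     case_prod (transition M) \<in> state_actions M \<rightarrow>\<^sub>M prob_algebra (states M) \<and>
     initial M \<in> space (prob_algebra (states M)) \<and>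
     case_prod (danger M) \<in> borel_measurable (state_actions M) \<and>
     (\<forall>s\<in>space (states M). \<forall>a. 0 \<le> danger M s a)"

type_synonym ('s, 'a) policy = "nat \<Rightarrow> 's \<Rightarrow> 'a pmf"

definition is_policy :: "('s, 'a) mdp \<Rightarrow> ('s, 'a) policy \<Rightarrow> bool" where
  "is_policy M \<pi> \<longleftrightarrow>
     (\<forall>t\<le>horizon M. (\<lambda>s. measure_pmf (\<pi> t s)) \<in> states M \<rightarrow>\<^sub>M prob_algebra (count_space UNIV))"

text \<open>The law of \<open>(s\<^sub>t, a\<^sub>t)\<close> given \<open>(s\<^bsub>t-1\<^esub>, a\<^bsub>t-1\<^esub>) = (s, a)\<close>.\<close>

definition step :: "('s, 'a) mdp \<Rightarrow> ('s, 'a) policy \<Rightarrow> nat \<Rightarrow> 's \<Rightarrow> 'a \<Rightarrow> ('s \<times> 'a) measure" where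
  "step M \<pi> t s a =
     transition M s a \<bind> (\<lambda>s'. distr (measure_pmf (\<pi> t s')) (state_actions M) (\<lambda>a'. (s', a')))"

text \<open>
  The law of \<open>(s\<^sub>t, a\<^sub>t), \<dots>, (s\<^bsub>t+n\<^esub>, a\<^bsub>t+n\<^esub>)\<close> given \<open>(s\<^sub>t, a\<^sub>t) = (s, a)\<close>. A trajectory \<open>\<omega>\<close> is
  indexed by absolute time, so \<open>\<omega> k = (s\<^sub>k, a\<^sub>k)\<close>. Expectations with respect to this kernel are the
  conditional expectations given \<open>s\<^sub>t = s\<close> and \<open>a\<^sub>t = a\<close>, defined for every \<open>(s, a)\<close> and not only
  almost everywhere.
\<close>

primrec trajectory ::
  "('s, 'a) mdp \<Rightarrow> ('s, 'a) policy \<Rightarrow> nat \<Rightarrow> 's \<Rightarrow> 'a \<Rightarrow> nat \<Rightarrow> (nat \<Rightarrow> 's \<times> 'a) measure" where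
  "trajectory M \<pi> t s a 0 =
     return (\<Pi>\<^sub>M k\<in>{t..t}. state_actions M) (\<lambda>k\<in>{t..t}. (s, a))"
| "trajectory M \<pi> t s a (Suc n) =
     trajectory M \<pi> t s a n \<bind> (\<lambda>\<omega>.
       case_prod (step M \<pi> (t + Suc n)) (\<omega> (t + n)) \<bind> (\<lambda>sa.
         return (\<Pi>\<^sub>M k\<in>{t..t + Suc n}. state_actions M) (fun_upd \<omega> (t + Suc n) sa)))"

text \<open>\<open>d\<^sub>k = d(s\<^bsub>k-1\<^esub>, a\<^bsub>k-1\<^esub>)\<close>; only used for \<open>k \<ge> 1\<close>.\<close>

definition danger_at :: "('s, 'a) mdp \<Rightarrow> (nat \<Rightarrow> 's \<times> 'a) \<Rightarrow> nat \<Rightarrow> real" where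
  "danger_at M \<omega> k = case_prod (danger M) (\<omega> (k - 1))"

text \<open>
  Dangers need not be integrable, so expectations of these nonnegative quantities are taken in
  \<open>[0, \<infinity>]\<close>.
\<close>

definition threat :: "('s, 'a) mdp \<Rightarrow> real \<Rightarrow> ('s, 'a) policy \<Rightarrow> nat \<Rightarrow> 's \<Rightarrow> 'a \<Rightarrow> ennreal" where
  "threat M \<beta> \<eta> t s a =
     (\<integral>\<^sup>+\<omega>. ennreal (\<Sum>k = t + 1..horizon M. \<beta> ^ (k - t) * danger_at M \<omega> k)
        \<partial>trajectory M \<eta> t s a (horizon M - t))"

definition initial_threat :: "('s, 'a) mdp \<Rightarrow> real \<Rightarrow> ('s, 'a) policy \<Rightarrow> 's \<Rightarrow> ennreal" where
  "initial_threat M \<beta> \<eta> s = (\<integral>\<^sup>+a. threat M \<beta> \<eta> 0 s a \<partial>measure_pmf (\<eta> 0 s))"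

definition safe_actions ::
  "('s, 'a) mdp \<Rightarrow> real \<Rightarrow> ('s, 'a) policy \<Rightarrow> real \<Rightarrow> 's \<Rightarrow> 'a set" where
  "safe_actions M \<beta> \<eta> x s = (\<Inter>t\<in>{0..horizon M}. {a. threat M \<beta> \<eta> t s a \<le> ennreal x})"

definition safe_states :: "('s, 'a) mdp \<Rightarrow> real \<Rightarrow> ('s, 'a) policy \<Rightarrow> real \<Rightarrow> 's set" where
  "safe_states M \<beta> \<eta> x = {s \<in> space (states M). safe_actions M \<beta> \<eta> x s \<noteq> {}}"

definition policy_class1 ::
  "('s, 'a) mdp \<Rightarrow> real \<Rightarrow> ('s, 'a) policy \<Rightarrow> real \<Rightarrow> ('s, 'a) policy set" where
  "policy_class1 M \<beta> \<eta> x = {\<pi>. is_policy M \<pi> \<and>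
     (\<forall>s\<in>safe_states M \<beta> \<eta> x. \<forall>t\<le>horizon M. set_pmf (\<pi> t s) \<subseteq> safe_actions M \<beta> \<eta> x s) \<and>
     (\<forall>s\<in>space (states M) - safe_states M \<beta> \<eta> x. \<forall>t\<le>horizon M.
        \<exists>a. \<pi> t s = return_pmf a \<and> (\<forall>b. threat M \<beta> \<eta> t s a \<le> threat M \<beta> \<eta> t s b))}"

definition threshold :: "('s, 'a) mdp \<Rightarrow> real \<Rightarrow> real \<Rightarrow> real" where
  "threshold M \<beta> c = c * inverse (1 + (\<Sum>t\<in>{1..<horizon M}. \<beta> ^ t))"

definition is_safe :: "('s, 'a) mdp \<Rightarrow> real \<Rightarrow> real \<Rightarrow> ('s, 'a) policy \<Rightarrow> bool" where
  "is_safe M \<beta> c \<pi> \<longleftrightarrow>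
     (\<integral>\<^sup>+s. \<integral>\<^sup>+a. threat M \<beta> \<pi> 0 s a \<partial>measure_pmf (\<pi> 0 s) \<partial>initial M) \<le> ennreal c"

end

theory Submission
  imports Defs
begin

text \<open>
  Write \<open>U\<^sub>t\<close>, \<open>W\<^sub>t\<close>, \<open>V\<^sub>t\<close> for the \<open>\<pi>\<^sub>t\<close>-average of the threat of \<open>\<pi>\<close>, the \<open>\<pi>\<^sub>t\<close>-average of the
  threat of \<open>\<eta>\<close>, and the \<open>\<eta>\<^sub>t\<close>-average of the threat of \<open>\<eta>\<close>. Membership in the policy class gives
  \<open>W\<^sub>t \<le> x\<close> on safe states and \<open>W\<^sub>t \<le> V\<^sub>t\<close> elsewhere, so \<open>W\<^sub>t \<le> V\<^sub>t + x\<close> everywhere. Feeding this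
  into the Bellman recursion of the threat, each future decision time except the last (whose
  threat vanishes) costs at most a discounted \<open>x\<close>, so that
  \<open>U\<^sub>0 \<le> W\<^sub>0 + x (\<beta> + \<dots> + \<beta>\<^bsup>T-1\<^esup>)\<close>; and \<open>W\<^sub>0 \<le> x\<close> by the assumption on the initial states.
\<close>

section \<open>Transition, action and one-step kernels\<close>

locale finite_horizon_mdp =
  fixes M :: "('s, 'a) mdp"
  assumes is_mdp: "is_mdp M"
begin

lemma measurable_transition [measurable]:
  "case_prod (transition M) \<in> state_actions M \<rightarrow>\<^sub>M prob_algebra (states M)"
  using is_mdp by (simp add: is_mdp_def)

lemma measurable_danger [measurable]:
  "case_prod (danger M) \<in> borel_measurable (state_actions M)"
  using is_mdp by (simp add: is_mdp_def)

lemma danger_nonneg: "p \<in> space (state_actions M) \<Longrightarrow> 0 \<le> case_prod (danger M) p"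
  using is_mdp by (auto simp: is_mdp_def space_pair_measure)

lemma transition_in_prob_algebra:
  assumes "s \<in> space (states M)"
  shows "transition M s a \<in> space (prob_algebra (states M))"
  using measurable_space[OF measurable_transition, of "(s, a)"] assms
  by (simp add: space_pair_measure)

lemma sets_transition:
  "s \<in> space (states M) \<Longrightarrow> sets (transition M s a) = sets (states M)"
  using transition_in_prob_algebra by (simp add: space_prob_algebra)

lemma space_transition:
  "s \<in> space (states M) \<Longrightarrow> space (transition M s a) = space (states M)"
  by (rule sets_eq_imp_space_eq) (rule sets_transition)

lemma prob_space_transition: "s \<in> space (states M) \<Longrightarrow> prob_space (transition M s a)"
  using transition_in_prob_algebra by (simp add: space_prob_algebra)

lemma measurable_policy:
  assumes "is_policy M \<pi>" "t \<le> horizon M"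
  shows "(\<lambda>s. measure_pmf (\<pi> t s)) \<in> states M \<rightarrow>\<^sub>M prob_algebra (count_space UNIV)"
  using assms by (simp add: is_policy_def)

lemma measurable_action_kernel:
  assumes "is_policy M \<pi>" "t \<le> horizon M"
  shows "(\<lambda>s. distr (measure_pmf (\<pi> t s)) (state_actions M) (\<lambda>a. (s, a)))
    \<in> states M \<rightarrow>\<^sub>M prob_algebra (state_actions M)"
  by (rule measurable_distr_prob_space2[OF measurable_policy[OF assms]]) simp

lemma measurable_step:
  assumes "is_policy M \<pi>" "t \<le> horizon M"
  shows "case_prod (step M \<pi> t) \<in> state_actions M \<rightarrow>\<^sub>M prob_algebra (state_actions M)"
  using measurable_bind_prob_space[OF measurable_transition measurable_action_kernel[OF assms]]
  by (simp add: step_def case_prod_beta')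

lemma nn_integral_action_kernel:
  assumes "s \<in> space (states M)" "f \<in> borel_measurable (state_actions M)"
  shows "(\<integral>\<^sup>+p. f p \<partial>distr (measure_pmf (\<pi> t s)) (state_actions M) (\<lambda>a. (s, a)))
    = (\<integral>\<^sup>+a. f (s, a) \<partial>measure_pmf (\<pi> t s))"
  using assms by (subst nn_integral_distr) (auto simp: space_pair_measure)

text \<open>Separates the successor state, whose law does not depend on the policy, from the action.
  When \<open>\<pi>\<close> is compared with \<open>\<eta>\<close>, both sides thus become integrals
  over the same \<open>transition M s a\<close>.\<close>

lemma nn_integral_step:
  assumes "is_policy M \<pi>" "t \<le> horizon M" "s \<in> space (states M)"
    and f: "f \<in> borel_measurable (state_actions M)"
  shows "(\<integral>\<^sup>+p. f p \<partial>step M \<pi> t s a)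
    = (\<integral>\<^sup>+s'. \<integral>\<^sup>+a'. f (s', a') \<partial>measure_pmf (\<pi> t s') \<partial>transition M s a)"
proof -
  have "(\<lambda>s. distr (measure_pmf (\<pi> t s)) (state_actions M) (\<lambda>a. (s, a)))
      \<in> transition M s a \<rightarrow>\<^sub>M subprob_algebra (state_actions M)"
    using measurable_prob_algebraD[OF measurable_action_kernel[OF assms(1,2)]]
    by (simp add: measurable_cong_sets[OF sets_transition[OF assms(3)] refl])
  then show ?thesis
    unfolding step_def
    by (subst nn_integral_bind[OF f])
      (auto intro!: nn_integral_cong nn_integral_action_kernel[OF _ f]
        simp: space_transition[OF assms(3)])
qed

lemma measurable_policy_average:
  assumes "is_policy M \<pi>" "t \<le> horizon M" "f \<in> borel_measurable (state_actions M)"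
  shows "(\<lambda>s. \<integral>\<^sup>+a. f (s, a) \<partial>measure_pmf (\<pi> t s)) \<in> borel_measurable (states M)"
  by (rule nn_integral_measurable_subprob_algebra2[OF _
        measurable_prob_algebraD[OF measurable_policy[OF assms(1,2)]]])
    (use assms(3) in simp)

section \<open>Backward recursion for the threat\<close>

text \<open>In \<open>bellman_threat \<beta> \<pi> n t\<close>, \<open>n\<close> is the number of steps left and \<open>t\<close> the current time.\<close>

primrec bellman_threat :: "real \<Rightarrow> ('s, 'a) policy \<Rightarrow> nat \<Rightarrow> nat \<Rightarrow> 's \<times> 'a \<Rightarrow> ennreal" where
  "bellman_threat \<beta> \<pi> 0 = (\<lambda>t p. 0)"
| "bellman_threat \<beta> \<pi> (Suc n) = (\<lambda>t p. ennreal \<beta> * (ennreal (case_prod (danger M) p)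
     + (\<integral>\<^sup>+q. bellman_threat \<beta> \<pi> n (Suc t) q \<partial>case_prod (step M \<pi> (Suc t)) p)))"

text \<open>The recursion meets the policy only at the times \<open>t + 1\<close>, ...,
  \<open>t + n\<close>; the bound on \<open>t + n\<close> keeps these in the range where
  \<open>is_policy\<close> provides measurability.\<close>

lemma measurable_bellman_threat:
  assumes "is_policy M \<pi>" "t + n \<le> horizon M"
  shows "bellman_threat \<beta> \<pi> n t \<in> borel_measurable (state_actions M)"
  using assms(2)
proof (induction n arbitrary: t)
  case (Suc n)
  have "(\<lambda>p. \<integral>\<^sup>+q. bellman_threat \<beta> \<pi> n (Suc t) q \<partial>case_prod (step M \<pi> (Suc t)) p)
      \<in> borel_measurable (state_actions M)"
    by (rule nn_integral_measurable_subprob_algebra2[OF _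
          measurable_prob_algebraD[OF measurable_step[OF assms(1)]]])
      (use Suc in \<open>auto intro!: measurable_compose[OF measurable_snd]\<close>)
  then show ?case
    by simp
qed simp

section \<open>Laws of trajectories\<close>

abbreviation paths :: "nat \<Rightarrow> nat \<Rightarrow> (nat \<Rightarrow> 's \<times> 'a) measure" where
  "paths t n \<equiv> \<Pi>\<^sub>M k\<in>{t..t + n}. state_actions M"

lemma measurable_coordinate:
  "k \<in> {t..t + n} \<Longrightarrow> (\<lambda>\<omega>. \<omega> k) \<in> paths t n \<rightarrow>\<^sub>M state_actions M"
  by (rule measurable_component_singleton)

lemma measurable_extend_path:
  "(\<lambda>(\<omega>, p). fun_upd \<omega> (t + Suc n) p) \<in> paths t n \<Otimes>\<^sub>M state_actions M \<rightarrow>\<^sub>M paths t (Suc n)"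
proof -
  have "{t..t + Suc n} = insert (t + Suc n) {t..t + n}"
    by auto
  then show ?thesis
    using measurable_add_dim[of "t + Suc n" "{t..t + n}" "\<lambda>_. state_actions M"] by simp
qed

lemma measurable_step_path:
  assumes "is_policy M \<pi>" "t + Suc n \<le> horizon M"
  shows "(\<lambda>\<omega>. case_prod (step M \<pi> (t + Suc n)) (\<omega> (t + n)))
    \<in> paths t n \<rightarrow>\<^sub>M prob_algebra (state_actions M)"
  by (rule measurable_compose[OF measurable_coordinate measurable_step[OF assms]]) simp

text \<open>This is the kernel bound to the shorter trajectory in the definition of
  \<open>trajectory\<close>: draw the next pair from the last coordinate and append it.\<close>

lemma measurable_extension_kernel:
  assumes "is_policy M \<pi>" "t + Suc n \<le> horizon M"
  shows "(\<lambda>\<omega>. case_prod (step M \<pi> (t + Suc n)) (\<omega> (t + n)) \<bind>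
      (\<lambda>p. return (paths t (Suc n)) (fun_upd \<omega> (t + Suc n) p)))
    \<in> paths t n \<rightarrow>\<^sub>M prob_algebra (paths t (Suc n))"
  by (rule measurable_bind_prob_space2[OF measurable_step_path[OF assms]])
    (use measurable_compose[OF measurable_extend_path measurable_return_prob_space]
      in \<open>simp add: case_prod_beta'\<close>)

lemma trajectory_in_prob_algebra:
  assumes "is_policy M \<pi>" "s \<in> space (states M)" "t + n \<le> horizon M"
  shows "trajectory M \<pi> t s a n \<in> space (prob_algebra (paths t n))"
  using assms(3)
proof (induction n)
  case 0
  have "(\<lambda>k\<in>{t..t}. (s, a)) \<in> space (paths t 0)"
    using assms(2) by (auto simp: space_PiM space_pair_measure)
  from measurable_space[OF measurable_return_prob_space this] show ?case
    by simp
next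
  case (Suc n)
  note kernel = measurable_extension_kernel[OF assms(1) Suc.prems]
  have "trajectory M \<pi> t s a n \<in> space (prob_algebra (paths t n))"
    using Suc by simp
  from prob_space_bind'[OF this kernel] sets_bind'[OF this kernel] show ?case
    by (simp add: space_prob_algebra)
qed

text \<open>Tower property for the last step: both binds in the recursion become iterated integrals,
  and the innermost \<open>return\<close> is an evaluation at the extended path.\<close>

lemma nn_integral_trajectory_Suc:
  assumes "is_policy M \<pi>" "s \<in> space (states M)" "t + Suc n \<le> horizon M"
    and f: "f \<in> borel_measurable (paths t (Suc n))"
  shows "(\<integral>\<^sup>+\<omega>. f \<omega> \<partial>trajectory M \<pi> t s a (Suc n))
    = (\<integral>\<^sup>+\<omega>. \<integral>\<^sup>+p. f (fun_upd \<omega> (t + Suc n) p) \<partial>case_prod (step M \<pi> (t + Suc n)) (\<omega> (t + n))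
        \<partial>trajectory M \<pi> t s a n)"
proof -
  note kernel = measurable_extension_kernel[OF assms(1,3)]
  have sets: "sets (trajectory M \<pi> t s a n) = sets (paths t n)"
    using trajectory_in_prob_algebra[OF assms(1,2), of t n] assms(3)
    by (simp add: space_prob_algebra)
  have inner: "(\<integral>\<^sup>+\<omega>'. f \<omega>' \<partial>(case_prod (step M \<pi> (t + Suc n)) (\<omega> (t + n)) \<bind>
        (\<lambda>p. return (paths t (Suc n)) (fun_upd \<omega> (t + Suc n) p))))
      = (\<integral>\<^sup>+p. f (fun_upd \<omega> (t + Suc n) p) \<partial>case_prod (step M \<pi> (t + Suc n)) (\<omega> (t + n)))"
    if \<omega>: "\<omega> \<in> space (paths t n)" for \<omega>
  proof -
    let ?K = "case_prod (step M \<pi> (t + Suc n)) (\<omega> (t + n))"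
    have K: "sets ?K = sets (state_actions M)"
      using measurable_space[OF measurable_step_path[OF assms(1,3)] \<omega>]
      by (simp add: space_prob_algebra)
    have upd: "(\<lambda>p. fun_upd \<omega> (t + Suc n) p) \<in> state_actions M \<rightarrow>\<^sub>M paths t (Suc n)"
      using measurable_compose[OF measurable_Pair1'[OF \<omega>] measurable_extend_path] by simp
    have "(\<lambda>p. return (paths t (Suc n)) (fun_upd \<omega> (t + Suc n) p))
        \<in> ?K \<rightarrow>\<^sub>M subprob_algebra (paths t (Suc n))"
      unfolding measurable_cong_sets[OF K refl]
      by (rule measurable_compose[OF upd return_measurable])
    from nn_integral_bind[OF f this]
    have "(\<integral>\<^sup>+\<omega>'. f \<omega>' \<partial>(?K \<bind> (\<lambda>p. return (paths t (Suc n)) (fun_upd \<omega> (t + Suc n) p))))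
        = (\<integral>\<^sup>+p. \<integral>\<^sup>+\<omega>'. f \<omega>' \<partial>return (paths t (Suc n)) (fun_upd \<omega> (t + Suc n) p) \<partial>?K)" .
    also have "\<dots> = (\<integral>\<^sup>+p. f (fun_upd \<omega> (t + Suc n) p) \<partial>?K)"
      by (intro nn_integral_cong nn_integral_return[OF _ f] measurable_space[OF upd])
        (simp only: sets_eq_imp_space_eq[OF K])
    finally show ?thesis .
  qed
  have "(\<integral>\<^sup>+\<omega>. f \<omega> \<partial>trajectory M \<pi> t s a (Suc n))
      = (\<integral>\<^sup>+\<omega>. \<integral>\<^sup>+\<omega>'. f \<omega>' \<partial>(case_prod (step M \<pi> (t + Suc n)) (\<omega> (t + n)) \<bind>
          (\<lambda>p. return (paths t (Suc n)) (fun_upd \<omega> (t + Suc n) p))) \<partial>trajectory M \<pi> t s a n)"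
    unfolding trajectory.simps
    by (rule nn_integral_bind[OF f])
      (use measurable_prob_algebraD[OF kernel] in
        \<open>simp add: measurable_cong_sets[OF sets refl]\<close>)
  also have "\<dots> = (\<integral>\<^sup>+\<omega>. \<integral>\<^sup>+p. f (fun_upd \<omega> (t + Suc n) p)
      \<partial>case_prod (step M \<pi> (t + Suc n)) (\<omega> (t + n)) \<partial>trajectory M \<pi> t s a n)"
    by (intro nn_integral_cong inner) (simp only: sets_eq_imp_space_eq[OF sets])
  finally show ?thesis .
qed

section \<open>The threat solves the recursion\<close>

text \<open>
  For fixed \<open>n + j\<close> this interpolates between the recursion (\<open>n = 0\<close>) and the expectation over
  trajectories (\<open>j = 0\<close>); trajectories grow at their end, hence the induction on \<open>n\<close>.
\<close>

lemma nn_integral_trajectory_bellman_threat: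
  assumes "is_policy M \<pi>" "s \<in> space (states M)" "t + n + j \<le> horizon M"
  shows "(\<integral>\<^sup>+\<omega>. (\<Sum>k<n. ennreal \<beta> ^ Suc k * ennreal (case_prod (danger M) (\<omega> (t + k))))
        + ennreal \<beta> ^ n * bellman_threat \<beta> \<pi> j (t + n) (\<omega> (t + n)) \<partial>trajectory M \<pi> t s a n)
    = bellman_threat \<beta> \<pi> (n + j) t (s, a)"
  using assms(3)
proof (induction n arbitrary: j)
  case 0
  have "(\<lambda>\<omega>. bellman_threat \<beta> \<pi> j t (\<omega> t)) \<in> borel_measurable (paths t 0)"
    by (rule measurable_compose[OF measurable_coordinate measurable_bellman_threat[OF assms(1)]])
      (use 0 in auto)
  moreover have "(\<lambda>k\<in>{t..t}. (s, a)) \<in> space (paths t 0)"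
    using assms(2) by (auto simp: space_PiM space_pair_measure)
  ultimately show ?case
    by (simp add: nn_integral_return)
next
  case (Suc n)
  let ?D = "\<lambda>n \<omega>. \<Sum>k<n. ennreal \<beta> ^ Suc k * ennreal (case_prod (danger M) (\<omega> (t + k)))"
  let ?Q = "bellman_threat \<beta> \<pi> j (t + Suc n)"
  have Q: "?Q \<in> borel_measurable (state_actions M)"
    using measurable_bellman_threat[OF assms(1)] Suc.prems by simp
  have D: "?D (Suc n) \<in> borel_measurable (paths t (Suc n))"
    by (auto intro!: borel_measurable_sum borel_measurable_times_ennreal measurable_compose[OF
          measurable_coordinate measurable_compose[OF measurable_danger measurable_ennreal]])
  have QQ: "(\<lambda>\<omega>. ?Q (\<omega> (t + Suc n))) \<in> borel_measurable (paths t (Suc n))"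
    by (rule measurable_compose[OF measurable_coordinate Q]) simp
  have sets: "sets (trajectory M \<pi> t s a n) = sets (paths t n)"
    using trajectory_in_prob_algebra[OF assms(1,2), of t n] Suc.prems
    by (simp add: space_prob_algebra)
  \<comment> \<open>Integrate out the newest pair. The sum \<open>?D (Suc n)\<close> reads only the
    coordinates up to \<open>t + n\<close>, so it is unaffected by the update and constant under a
    probability measure. Its top summand, \<open>k = n\<close>, and the integral of
    \<open>?Q\<close> together form \<open>bellman_threat\<close> with \<open>Suc j\<close> steps
    left, scaled by \<open>ennreal \<beta> ^ n\<close>.\<close>
  have inner: "(\<integral>\<^sup>+p. ?D (Suc n) (fun_upd \<omega> (t + Suc n) p)
        + ennreal \<beta> ^ Suc n * ?Q ((fun_upd \<omega> (t + Suc n) p) (t + Suc n))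
        \<partial>case_prod (step M \<pi> (t + Suc n)) (\<omega> (t + n)))
      = ?D n \<omega> + ennreal \<beta> ^ n * bellman_threat \<beta> \<pi> (Suc j) (t + n) (\<omega> (t + n))"
    if \<omega>: "\<omega> \<in> space (paths t n)" for \<omega>
  proof -
    let ?K = "case_prod (step M \<pi> (t + Suc n)) (\<omega> (t + n))"
    have K: "?K \<in> space (prob_algebra (state_actions M))"
      using Suc.prems by (intro measurable_space[OF measurable_step_path[OF assms(1)] \<omega>]) simp
    have Q': "?Q \<in> borel_measurable ?K"
      using K Q measurable_cong_sets[of ?K "state_actions M" borel borel]
      by (auto simp: space_prob_algebra)
    have "emeasure ?K (space ?K) = 1"
      using K by (simp add: space_prob_algebra prob_space.emeasure_space_1)
    then have "(\<integral>\<^sup>+p. ?D (Suc n) \<omega> + ennreal \<beta> ^ Suc n * ?Q p \<partial>?K)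
        = ?D (Suc n) \<omega> + ennreal \<beta> ^ Suc n * (\<integral>\<^sup>+p. ?Q p \<partial>?K)"
      using Q' by (simp add: nn_integral_add nn_integral_cmult)
    then show ?thesis
      by (simp add: algebra_simps)
  qed
  have "(\<integral>\<^sup>+\<omega>. ?D (Suc n) \<omega> + ennreal \<beta> ^ Suc n * ?Q (\<omega> (t + Suc n))
        \<partial>trajectory M \<pi> t s a (Suc n))
      = (\<integral>\<^sup>+\<omega>. ?D n \<omega> + ennreal \<beta> ^ n * bellman_threat \<beta> \<pi> (Suc j) (t + n) (\<omega> (t + n))
        \<partial>trajectory M \<pi> t s a n)"
  proof (subst nn_integral_trajectory_Suc[OF assms(1,2)])
    show "t + Suc n \<le> horizon M"
      using Suc.prems by simp
    show "(\<lambda>\<omega>. ?D (Suc n) \<omega> + ennreal \<beta> ^ Suc n * ?Q (\<omega> (t + Suc n)))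
        \<in> borel_measurable (paths t (Suc n))"
      using D QQ by (intro borel_measurable_add borel_measurable_times_ennreal borel_measurable_const)
  qed (intro nn_integral_cong inner, simp only: sets_eq_imp_space_eq[OF sets])
  \<comment> \<open>One step moves from the trajectory to the recursion, so the total
    \<open>n + Suc j = Suc n + j\<close> is preserved; this is why \<open>j\<close> must be
    arbitrary in the induction.\<close>
  also have "\<dots> = bellman_threat \<beta> \<pi> (n + Suc j) t (s, a)"
    using Suc.prems by (intro Suc.IH) simp
  finally show ?case
    by simp
qed

text \<open>The case \<open>j = 0\<close> of the interpolation, where the continuation value is
  zero. What remains is to align the discounted sums on paths inside the product space.\<close>

lemma threat_eq_bellman_threat:
  assumes "is_policy M \<pi>" "s \<in> space (states M)" "t \<le> horizon M" "0 \<le> \<beta>"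
  shows "threat M \<beta> \<pi> t s a = bellman_threat \<beta> \<pi> (horizon M - t) t (s, a)"
proof -
  define n where "n = horizon M - t"
  have T: "horizon M = t + n"
    using assms(3) by (simp add: n_def)
  have sets: "sets (trajectory M \<pi> t s a n) = sets (paths t n)"
    using trajectory_in_prob_algebra[OF assms(1,2), of t n] T by (simp add: space_prob_algebra)
  have "ennreal (\<Sum>k = t + 1..horizon M. \<beta> ^ (k - t) * danger_at M \<omega> k)
      = (\<Sum>k<n. ennreal \<beta> ^ Suc k * ennreal (case_prod (danger M) (\<omega> (t + k))))"
    if \<omega>: "\<omega> \<in> space (paths t n)" for \<omega>
  proof -
    \<comment> \<open>Dangers are known to be nonnegative only over the state space; nonnegativity
      is what lets \<open>ennreal\<close> pass through the sum and the products.\<close>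
    have "\<omega> (t + k) \<in> space (state_actions M)" if "k < n" for k
      using \<omega> that by (auto simp: space_PiM PiE_iff)
    then have nonneg: "0 \<le> case_prod (danger M) (\<omega> (t + k))" if "k < n" for k
      using that danger_nonneg by blast
    \<comment> \<open>\<open>danger_at\<close> reads coordinate \<open>k - 1\<close>, so time
      \<open>t + Suc k\<close> corresponds to coordinate \<open>t + k\<close> with discount exponent
      \<open>Suc k\<close>. The final pair, at the horizon, contributes no danger.\<close>
    have "(\<Sum>k = t + 1..horizon M. \<beta> ^ (k - t) * danger_at M \<omega> k)
        = (\<Sum>k<n. \<beta> ^ Suc k * case_prod (danger M) (\<omega> (t + k)))"
      unfolding danger_at_def T
      by (rule sum.reindex_bij_witness[where i = "\<lambda>k. t + Suc k" and j = "\<lambda>k. k - Suc t"])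
        (auto simp: Suc_diff_Suc simp flip: power_Suc)
    also have "ennreal \<dots> = (\<Sum>k<n. ennreal (\<beta> ^ Suc k * case_prod (danger M) (\<omega> (t + k))))"
      using assms(4) nonneg by (intro sum_ennreal[symmetric] mult_nonneg_nonneg) auto
    also have "\<dots> = (\<Sum>k<n. ennreal \<beta> ^ Suc k * ennreal (case_prod (danger M) (\<omega> (t + k))))"
      using assms(4) nonneg
      by (intro sum.cong refl) (simp only: lessThan_iff ennreal_mult ennreal_power zero_le_power)
    finally show ?thesis .
  qed
  then have "threat M \<beta> \<pi> t s a
      = (\<integral>\<^sup>+\<omega>. (\<Sum>k<n. ennreal \<beta> ^ Suc k * ennreal (case_prod (danger M) (\<omega> (t + k))))
          \<partial>trajectory M \<pi> t s a n)"
    unfolding threat_def n_def[symmetric]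
    by (intro nn_integral_cong) (simp add: sets_eq_imp_space_eq[OF sets])
  also have "\<dots> = bellman_threat \<beta> \<pi> n t (s, a)"
    using nn_integral_trajectory_bellman_threat[OF assms(1,2), of t n 0 a \<beta>] T by simp
  finally show ?thesis
    by (simp add: n_def)
qed

section \<open>Comparison of the threats of the two policies\<close>

text \<open>Induction on the number of steps left: at each later decision time, replacing the first
  action of \<open>\<eta>\<close> by that of \<open>\<pi>\<close> costs at most \<open>x\<close> by
  \<open>excess\<close>, and the recursion discounts all accumulated costs by one more factor
  \<open>\<beta>\<close>.\<close>

lemma bellman_threat_le_add_geometric:
  assumes "is_policy M \<pi>" "is_policy M \<eta>" "0 \<le> \<beta>" "0 \<le> x"
    and excess: "\<And>s t. s \<in> space (states M) \<Longrightarrow> t \<le> horizon M \<Longrightarrow>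
      (\<integral>\<^sup>+a. bellman_threat \<beta> \<eta> (horizon M - t) t (s, a) \<partial>measure_pmf (\<pi> t s))
      \<le> (\<integral>\<^sup>+a. bellman_threat \<beta> \<eta> (horizon M - t) t (s, a) \<partial>measure_pmf (\<eta> t s)) + ennreal x"
    and "t + n = horizon M" "s \<in> space (states M)"
  shows "bellman_threat \<beta> \<pi> n t (s, a)
    \<le> bellman_threat \<beta> \<eta> n t (s, a) + ennreal (x * (\<Sum>k\<in>{1..<n}. \<beta> ^ k))"
  using assms(6,7)
proof (induction n arbitrary: t s a)
  case (Suc n)
  define B where "B = (\<Sum>k\<in>{1..<n}. \<beta> ^ k)"
  have B: "0 \<le> B"
    using assms(3) by (auto simp: B_def intro!: sum_nonneg)
  have T: "Suc t \<le> horizon M" "horizon M - Suc t = n"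
    using Suc.prems(1) by auto
  let ?\<pi> = "bellman_threat \<beta> \<pi> n (Suc t)" and ?\<eta> = "bellman_threat \<beta> \<eta> n (Suc t)"
  have m\<pi>: "?\<pi> \<in> borel_measurable (state_actions M)"
    and m\<eta>: "?\<eta> \<in> borel_measurable (state_actions M)"
    using Suc.prems(1) by (auto intro!: measurable_bellman_threat assms(1,2))
  show ?case
  \<comment> \<open>With one step left both continuation values vanish and no \<open>x\<close> is
    paid. This is why the geometric sum stops before the exponent equal to the number of steps
    left.\<close>
  proof (cases "n = 0")
    case True
    then show ?thesis
      by simp
  next
    case False
    \<comment> \<open>Two changes in turn: the induction hypothesis replaces the continuation policy
      while the action is still drawn from \<open>\<pi>\<close>, at cost \<open>x * B\<close>; then
      \<open>excess\<close> replaces the law of that action, at cost \<open>x\<close>.\<close>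
    have "(\<integral>\<^sup>+a'. ?\<pi> (s', a') \<partial>measure_pmf (\<pi> (Suc t) s'))
        \<le> (\<integral>\<^sup>+a'. ?\<eta> (s', a') \<partial>measure_pmf (\<eta> (Suc t) s')) + ennreal (x * (1 + B))"
      if s': "s' \<in> space (states M)" for s'
    proof -
      have "(\<integral>\<^sup>+a'. ?\<pi> (s', a') \<partial>measure_pmf (\<pi> (Suc t) s'))
          \<le> (\<integral>\<^sup>+a'. ?\<eta> (s', a') + ennreal (x * B) \<partial>measure_pmf (\<pi> (Suc t) s'))"
        using Suc.IH[of "Suc t" s'] Suc.prems s' by (intro nn_integral_mono) (simp add: B_def)
      also have "\<dots> = (\<integral>\<^sup>+a'. ?\<eta> (s', a') \<partial>measure_pmf (\<pi> (Suc t) s')) + ennreal (x * B)"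
        by (simp add: nn_integral_add)
      also have "\<dots> \<le> (\<integral>\<^sup>+a'. ?\<eta> (s', a') \<partial>measure_pmf (\<eta> (Suc t) s')) + ennreal x
          + ennreal (x * B)"
        using excess[OF s' T(1)] by (intro add_right_mono) (simp add: T(2))
      also have "\<dots> = (\<integral>\<^sup>+a'. ?\<eta> (s', a') \<partial>measure_pmf (\<eta> (Suc t) s')) + ennreal (x * (1 + B))"
        using assms(4) B by (simp add: ennreal_plus distrib_left add.assoc)
      finally show ?thesis .
    qed
    then have "(\<integral>\<^sup>+q. ?\<pi> q \<partial>step M \<pi> (Suc t) s a)
        \<le> (\<integral>\<^sup>+s'. (\<integral>\<^sup>+a'. ?\<eta> (s', a') \<partial>measure_pmf (\<eta> (Suc t) s')) + ennreal (x * (1 + B))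
            \<partial>transition M s a)"
      unfolding nn_integral_step[OF assms(1) T(1) Suc.prems(2) m\<pi>]
      by (intro nn_integral_mono) (simp add: space_transition[OF Suc.prems(2)])
    also have "\<dots> = (\<integral>\<^sup>+s'. \<integral>\<^sup>+a'. ?\<eta> (s', a') \<partial>measure_pmf (\<eta> (Suc t) s') \<partial>transition M s a)
        + ennreal (x * (1 + B))"
      using measurable_policy_average[OF assms(2) T(1) m\<eta>]
        prob_space.emeasure_space_1[OF prob_space_transition[OF Suc.prems(2), of a]]
      by (subst nn_integral_add)
        (simp_all add: measurable_cong_sets[OF sets_transition[OF Suc.prems(2)] refl])
    also have "\<dots> = (\<integral>\<^sup>+q. ?\<eta> q \<partial>step M \<eta> (Suc t) s a) + ennreal (x * (1 + B))"
      by (simp add: nn_integral_step[OF assms(2) T(1) Suc.prems(2) m\<eta>])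
    finally have "bellman_threat \<beta> \<pi> (Suc n) t (s, a)
        \<le> ennreal \<beta> * (ennreal (danger M s a) + ((\<integral>\<^sup>+q. ?\<eta> q \<partial>step M \<eta> (Suc t) s a)
            + ennreal (x * (1 + B))))"
      by (simp add: mult_left_mono add_left_mono)
    also have "\<dots> = bellman_threat \<beta> \<eta> (Suc n) t (s, a) + ennreal \<beta> * ennreal (x * (1 + B))"
      by (simp add: distrib_left add.assoc)
    also have "ennreal \<beta> * ennreal (x * (1 + B)) = ennreal (x * (\<beta> * (1 + B)))"
      using assms(3,4) B by (simp add: ennreal_mult[symmetric] mult.left_commute)
    \<comment> \<open>The new cost is the exponent-zero term, and the factor \<open>\<beta>\<close>
      shifts every exponent by one. Splitting off that term requires \<open>n\<close> to be
      positive.\<close>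
    also have "\<beta> * (1 + B) = (\<Sum>k\<in>{1..<Suc n}. \<beta> ^ k)"
    proof -
      have "(\<Sum>k\<in>{1..<Suc n}. \<beta> ^ k) = (\<Sum>k\<in>{0..<n}. \<beta> * \<beta> ^ k)"
        using sum.shift_bounds_Suc_ivl[of "\<lambda>k. \<beta> ^ k" 0 n] by simp
      also have "\<dots> = \<beta> * (1 + B)"
        using False by (simp add: sum_distrib_left[symmetric] sum.atLeast_Suc_lessThan B_def)
      finally show ?thesis
        by simp
    qed
    finally show ?thesis .
  qed
qed simp

section \<open>Safety of the policy class\<close>

text \<open>On safe states the bound holds on the support of \<open>\<pi> t s\<close>; elsewhere a
  minimum is below any average. The disjunction is stronger than the additive bound
  \<open>excess\<close>: at time zero it yields the bound \<open>x\<close> itself.\<close>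

lemma policy_class1_average_threat:
  assumes "\<pi> \<in> policy_class1 M \<beta> \<eta> x" "s \<in> space (states M)" "t \<le> horizon M"
  shows "(\<integral>\<^sup>+a. threat M \<beta> \<eta> t s a \<partial>measure_pmf (\<pi> t s)) \<le> ennreal x \<or>
    (\<integral>\<^sup>+a. threat M \<beta> \<eta> t s a \<partial>measure_pmf (\<pi> t s))
      \<le> (\<integral>\<^sup>+a. threat M \<beta> \<eta> t s a \<partial>measure_pmf (\<eta> t s))"
proof (cases "s \<in> safe_states M \<beta> \<eta> x")
  case True
  then have "set_pmf (\<pi> t s) \<subseteq> safe_actions M \<beta> \<eta> x s"
    using assms by (auto simp: policy_class1_def)
  then have "AE a in measure_pmf (\<pi> t s). threat M \<beta> \<eta> t s a \<le> ennreal x"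
    using assms(3) by (auto simp: AE_measure_pmf_iff safe_actions_def)
  from nn_integral_mono_AE[OF this] show ?thesis
    by simp
next
  case False
  then obtain a where a: "\<pi> t s = return_pmf a" "\<And>b. threat M \<beta> \<eta> t s a \<le> threat M \<beta> \<eta> t s b"
    using assms unfolding policy_class1_def by blast
  have "threat M \<beta> \<eta> t s a = (\<integral>\<^sup>+b. threat M \<beta> \<eta> t s a \<partial>measure_pmf (\<eta> t s))"
    by simp
  also have "\<dots> \<le> (\<integral>\<^sup>+b. threat M \<beta> \<eta> t s b \<partial>measure_pmf (\<eta> t s))"
    by (intro nn_integral_mono a(2))
  finally show ?thesis
    by (simp add: a(1))
qed

theorem policy_class1_safe:
  assumes "0 \<le> \<beta>" "0 \<le> c" "is_policy M \<eta>"
    and initial: "AE s in initial M. initial_threat M \<beta> \<eta> s \<le> ennreal (threshold M \<beta> c)"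
    and \<pi>: "\<pi> \<in> policy_class1 M \<beta> \<eta> (threshold M \<beta> c)"
  shows "is_safe M \<beta> c \<pi>"
proof -
  define x where "x = threshold M \<beta> c"
  define B where "B = (\<Sum>k\<in>{1..<horizon M}. \<beta> ^ k)"
  have B: "0 \<le> B"
    using assms(1) by (auto simp: B_def intro!: sum_nonneg)
  have x_eq: "x = c / (1 + B)"
    by (simp add: x_def threshold_def B_def divide_inverse)
  \<comment> \<open>The threshold is calibrated for this identity: \<open>x\<close> pays for time
    zero, \<open>x * B\<close> for the later decision times before the horizon.\<close>
  have "x * (1 + B) = c"
    using B by (simp add: x_eq)
  moreover have "0 \<le> x"
    using B assms(2) by (simp add: x_eq)
  ultimately have x: "0 \<le> x" "x + x * B = c"
    by (simp_all add: distrib_left)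
  have is_policy: "is_policy M \<pi>"
    using \<pi> by (simp add: policy_class1_def)
  have excess: "(\<integral>\<^sup>+a. bellman_threat \<beta> \<eta> (horizon M - t) t (s, a) \<partial>measure_pmf (\<pi> t s))
      \<le> (\<integral>\<^sup>+a. bellman_threat \<beta> \<eta> (horizon M - t) t (s, a) \<partial>measure_pmf (\<eta> t s)) + ennreal x"
    if "s \<in> space (states M)" "t \<le> horizon M" for s t
  proof -
    have le: "w \<le> y \<or> w \<le> v \<Longrightarrow> w \<le> v + y" for w v y :: ennreal
      by (auto intro: add_increasing add_increasing2)
    show ?thesis
      using le[OF policy_class1_average_threat[OF \<pi> that]]
      unfolding threat_eq_bellman_threat[OF assms(3) that assms(1)] x_def .
  qed
  have "initial M \<in> space (prob_algebra (states M))"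
    using is_mdp by (simp add: is_mdp_def)
  then have P0: "space (initial M) = space (states M)" "prob_space (initial M)"
    using sets_eq_imp_space_eq[of "initial M" "states M"] by (simp_all add: space_prob_algebra)
  \<comment> \<open>The bound holds separately for almost every initial state, so averaging over a
    probability measure preserves it.\<close>
  have "AE s in initial M. (\<integral>\<^sup>+a. threat M \<beta> \<pi> 0 s a \<partial>measure_pmf (\<pi> 0 s)) \<le> ennreal c"
    using initial AE_space
  proof eventually_elim
    case (elim s)
    then have s: "s \<in> space (states M)"
      by (simp add: P0)
    have le: "threat M \<beta> \<pi> 0 s a \<le> threat M \<beta> \<eta> 0 s a + ennreal (x * B)" for a
      using bellman_threat_le_add_geometric[OF is_policy assms(3,1) x(1) excess _ s,
          where t = 0 and n = "horizon M" and a = a]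
      unfolding threat_eq_bellman_threat[OF is_policy s zero_le assms(1)]
        threat_eq_bellman_threat[OF assms(3) s zero_le assms(1)] B_def
      by simp
    have "(\<integral>\<^sup>+a. threat M \<beta> \<pi> 0 s a \<partial>measure_pmf (\<pi> 0 s))
        \<le> (\<integral>\<^sup>+a. threat M \<beta> \<eta> 0 s a + ennreal (x * B) \<partial>measure_pmf (\<pi> 0 s))"
      by (intro nn_integral_mono le)
    also have "\<dots> = (\<integral>\<^sup>+a. threat M \<beta> \<eta> 0 s a \<partial>measure_pmf (\<pi> 0 s)) + ennreal (x * B)"
      by (simp add: nn_integral_add)
    \<comment> \<open>In the second alternative the average is at most
      \<open>initial_threat\<close>, which the assumption on the initial states bounds by
      \<open>x\<close>.\<close>
    also have "\<dots> \<le> ennreal x + ennreal (x * B)"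
      using policy_class1_average_threat[OF \<pi> s zero_le] elim(1)
      unfolding initial_threat_def x_def by (intro add_right_mono) (blast intro: order_trans)
    also have "\<dots> = ennreal c"
      using x B by (subst ennreal_plus[symmetric]) auto
    finally show ?case .
  qed
  from nn_integral_mono_AE[OF this] show ?thesis
    by (simp add: is_safe_def prob_space.emeasure_space_1[OF P0(2)])
qed

end

theorem corollary2:
  fixes M :: "('s, 'a) mdp" and \<beta> c :: real and \<eta> :: "('s, 'a) policy"
  assumes "is_mdp M"
    and "0 \<le> \<beta>" and "\<beta> < 1" and "0 \<le> c"
    and "is_policy M \<eta>"
    and "AE s in initial M. initial_threat M \<beta> \<eta> s \<le> ennreal (threshold M \<beta> c)"
  shows "\<forall>\<pi>\<in>policy_class1 M \<beta> \<eta> (threshold M \<beta> c). is_safe M \<beta> c \<pi>"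
proof -
  interpret finite_horizon_mdp M
    by unfold_locales (rule assms(1))
  show ?thesis
    by (intro ballI policy_class1_safe[OF assms(2,4,5,6)])
qed

end
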